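(* Let $n\ge 2$ and $2\le k\le n$ be integers, and set $$\alpha=\frac{n}{n(k-1)+2k},\quad \beta=\frac{1}{n(k-1)+2k},\quad c_{n,k}=\frac1n\binom nk,\quad \gamma=\frac{k-1}{2k}\left(\frac{\beta}{c_{n,k}}\right)^{1/k}.$$ For every constant $C>0$, define for $t>0$, $x\in\mathbb{R}^n$ $$U_C(t,x)=t^{-\alpha}\left(C-\gamma\left(\frac{|x|}{t^{\beta}}\right)^2\right)_+^{\frac{k}{k-1}}.$$ Then $U_C$ is a nonnegative self-similar solution of $$u_t=(-1)^{k-1}S_k(D^2u)\quad\text{on } (0,\infty)\times\mathbb{R}^n$$ in the following sense, and has the following properties: (i) everywhere in $(0,\infty)\times\mathbb{R}^n$ except on the degeneracy surface $\left\{(t,x): |x|=t^\beta\left[\frac{2k}{k-1}\left(\frac{c_{n,k}}{\beta}\right)^{1/k}C\right]^{1/2}\right\}$, $U_C$ is infinitely differentiable and satisfies the equation classically; (ii) for every $t>0$, $\operatorname{supp}U_C(t,\cdot)$ is contained in the closed ball centered at $0$ of radius $t^\beta\left[\frac{2k}{k-1}\left(\frac{c_{n,k}}{\beta}\right)^{1/k}C\right]^{1/2}$ (in particular, it is compact, and there is finite speed of propagation); (iii) (mass conservation) there is a constant $M=M(C)>0$ such that $\int_{\mathbb{R}^n}U_C(t,x)\,dx=M$ for all $t>0$; (iv) $\lim_{t\to0^+}U_C(t,\cdot)=M\delta_0$, where $\delta_0$ is Dirac's delta concentrated at $0$.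
   Context: For a $C^2$ function $u$, $D^2u$ denotes its Hessian matrix with respect to $x\in\mathbb{R}^n$, and $S_k(D^2u)=\sum_{1\le i_1<\dots<i_k\le n}\lambda_{i_1}\cdots\lambda_{i_k}$, where $\lambda_1,\dots,\lambda_n$ are the eigenvalues of $D^2u$. $(\cdot)_+$ denotes the positive part, $(s)_+=\max\{s,0\}$. Self-similar means of the form $u(t,x)=t^{-\alpha}\theta(x/t^\beta)$. The limit in (iv) is in the sense of distributions (measures). *)

theory Defs
  imports "HOL-Probability.Probability" "HOL-Computational_Algebra.Computational_Algebra"
begin

text \<open>Eigenvalues of a real square matrix as the increasing list of the real roots of its
  characteristic polynomial, repeated according to multiplicity. For a symmetric matrix,
  such as the Hessian of a \<open>C\<^sup>2\<close> function, this list has length \<open>CARD('n)\<close>.\<close>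

definition charpoly :: "real ^ 'n ^ 'n \<Rightarrow> real poly" where
  "charpoly A = det (\<chi> i j. (if i = j then [:0, 1:] else 0) - [:A $ i $ j:])"

definition eigenvalues :: "real ^ 'n ^ 'n \<Rightarrow> real list" where
  "eigenvalues A = sorted_list_of_multiset (proots (charpoly A))"

definition S_k :: "nat \<Rightarrow> real ^ 'n ^ 'n \<Rightarrow> real" where
  "S_k k A = (\<Sum>I | I \<subseteq> {..<length (eigenvalues A)} \<and> card I = k. \<Prod>i\<in>I. eigenvalues A ! i)"

definition partial_deriv :: "'n \<Rightarrow> (real ^ 'n \<Rightarrow> real) \<Rightarrow> real ^ 'n \<Rightarrow> real" where
  "partial_deriv i f x = deriv (\<lambda>s. f (x + s *\<^sub>R axis i 1)) 0"

definition hessian :: "(real ^ 'n \<Rightarrow> real) \<Rightarrow> real ^ 'n \<Rightarrow> real ^ 'n ^ 'n" where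
  "hessian f x = (\<chi> i j. partial_deriv i (partial_deriv j f) x)"

text \<open>\<open>f\<close> is of class \<open>C\<^sup>m\<close> on \<open>S\<close>; intended for open \<open>S\<close>.\<close>

primrec C_diff_on :: "nat \<Rightarrow> 'a set \<Rightarrow> ('a::euclidean_space \<Rightarrow> real) \<Rightarrow> bool" where
  "C_diff_on 0 S f \<longleftrightarrow> continuous_on S f"
| "C_diff_on (Suc m) S f \<longleftrightarrow>
     (\<forall>x\<in>S. f differentiable (at x)) \<and>
     (\<forall>v. C_diff_on m S (\<lambda>x. frechet_derivative f (at x) v))"

definition smooth_on :: "'a set \<Rightarrow> ('a::euclidean_space \<Rightarrow> real) \<Rightarrow> bool" where
  "smooth_on S f \<longleftrightarrow> (\<forall>m. C_diff_on m S f)"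

definition supp :: "('a::topological_space \<Rightarrow> real) \<Rightarrow> 'a set" where
  "supp f = closure {x. f x \<noteq> 0}"

definition self_similar :: "real \<Rightarrow> real \<Rightarrow> (real \<Rightarrow> 'a::real_vector \<Rightarrow> real) \<Rightarrow> bool" where
  "self_similar \<alpha> \<beta> u \<longleftrightarrow>
     (\<exists>\<theta>. \<forall>t>0. \<forall>x. u t x = t powr (-\<alpha>) * \<theta> (x /\<^sub>R (t powr \<beta>)))"

text \<open>Convergence of finite Borel measures tested against bounded continuous functions;
  in particular it implies convergence as distributions.\<close>

definition measures_tendsto ::
    "('i \<Rightarrow> 'a::topological_space measure) \<Rightarrow> 'a measure \<Rightarrow> 'i filter \<Rightarrow> bool" where
  "measures_tendsto \<mu> \<nu> F \<longleftrightarrow>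
     (\<forall>\<phi> :: 'a \<Rightarrow> real. continuous_on UNIV \<phi> \<longrightarrow> bounded (range \<phi>) \<longrightarrow>
        ((\<lambda>i. \<integral>x. \<phi> x \<partial>\<mu> i) \<longlongrightarrow> (\<integral>x. \<phi> x \<partial>\<nu>)) F)"

definition alpha_exp :: "nat \<Rightarrow> nat \<Rightarrow> real" where
  "alpha_exp n k = real n / (real n * (real k - 1) + 2 * real k)"

definition beta_exp :: "nat \<Rightarrow> nat \<Rightarrow> real" where
  "beta_exp n k = 1 / (real n * (real k - 1) + 2 * real k)"

definition c_const :: "nat \<Rightarrow> nat \<Rightarrow> real" where
  "c_const n k = 1 / real n * real (n choose k)"

definition gamma_const :: "nat \<Rightarrow> nat \<Rightarrow> real" where
  "gamma_const n k =
     (real k - 1) / (2 * real k) * (beta_exp n k / c_const n k) powr (1 / real k)"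

definition barenblatt :: "nat \<Rightarrow> real \<Rightarrow> real \<Rightarrow> real ^ 'n \<Rightarrow> real" where
  "barenblatt k C t x =
     t powr (- alpha_exp CARD('n) k) *
     (max (C - gamma_const CARD('n) k * (norm x / t powr beta_exp CARD('n) k)\<^sup>2) 0)
       powr (real k / (real k - 1))"

definition front_radius :: "nat \<Rightarrow> nat \<Rightarrow> real \<Rightarrow> real \<Rightarrow> real" where
  "front_radius n k C t =
     t powr beta_exp n k *
     sqrt (2 * real k / (real k - 1) * (c_const n k / beta_exp n k) powr (1 / real k) * C)"

end

theory Submission
  imports Defs
begin

text \<open>Where \<open>U\<close> is positive, its Hessian is a multiple of the identity plus a multiple of
  \<open>x x\<^sup>T\<close>, so its eigenvalues are \<open>\<nu>\<close> (with multiplicity \<open>n - 1\<close>) and \<open>\<nu> + b \<bar>x\<bar>\<^sup>2\<close>. Hence \<open>S\<^sub>k\<close> is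
  explicit, and with \<open>p = k/(k-1)\<close> the identity \<open>(p - 1)(k - 1) = 1\<close> makes it, like \<open>U\<^sub>t\<close>,
  \<open>w powr (p - 1)\<close> (\<open>w\<close> the base of the power in \<open>U\<close>) times an affine function of \<open>\<bar>x\<bar>\<^sup>2\<close>; the values of \<open>\<alpha>, \<beta>, \<gamma>\<close> match the coefficients and
  the powers of \<open>t\<close>. Since \<open>\<alpha> = n \<beta>\<close>, the scaling is mass preserving, and the substitution
  \<open>x = t\<^sup>\<beta> y\<close> gives (iii) and (iv).\<close>

unbundle no fps_syntax

section \<open>Elementary symmetric functions of rank-one perturbations\<close>

text \<open>This is \<open>c I + b x x^T\<close>, the form of the Hessian of a smooth radial
  function. Subtracting it from \<open>z I\<close> gives a matrix of the same form, so one
  determinant formula also yields the characteristic polynomial.\<close>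

definition scalar_plus_rank_one :: "real \<Rightarrow> real \<Rightarrow> real ^ 'n \<Rightarrow> real ^ 'n ^ 'n" where
  "scalar_plus_rank_one c b x = (\<chi> i j. (if i = j then c else 0) + b * x $ i * x $ j)"

text \<open>The action sees \<open>y\<close> only through \<open>y\<close> itself and
  \<open>x \<bullet> y\<close>; this makes it easy to transport along an orthogonal map.\<close>

lemma scalar_plus_rank_one_vector_mult:
  "scalar_plus_rank_one c b x *v y = c *\<^sub>R y + (b * (x \<bullet> y)) *\<^sub>R x"
proof -
  have "(\<Sum>j\<in>UNIV. ((if i = j then c else 0) + b * x $ i * x $ j) * y $ j)
      = c * y $ i + b * (x \<bullet> y) * x $ i" for i
  proof -
    have "(\<Sum>j\<in>UNIV. ((if i = j then c else 0) + b * x $ i * x $ j) * y $ j)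
        = (\<Sum>j\<in>UNIV. if i = j then c * y $ j else 0) + (\<Sum>j\<in>UNIV. b * x $ i * (x $ j * y $ j))"
      by (subst sum.distrib [symmetric], rule sum.cong) (auto simp: algebra_simps)
    also have "\<dots> = c * y $ i + b * (x \<bullet> y) * x $ i"
      by (simp add: inner_vec_def sum_distrib_left [symmetric])
    finally show ?thesis .
  qed
  then show ?thesis
    by (simp add: vec_eq_iff matrix_vector_mult_def scalar_plus_rank_one_def)
qed

text \<open>An orthogonal map taking \<open>x\<close> to a multiple of a basis vector diagonalises the matrix.\<close>

lemma det_scalar_plus_rank_one:
  fixes x :: "real ^ 'n"
  shows "det (scalar_plus_rank_one c b x) = c ^ (CARD('n) - 1) * (c + b * (x \<bullet> x))"
proof -
  obtain k :: 'n where True by simp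
  define w where "w = norm x *\<^sub>R (axis k 1 :: real ^ 'n)"
  have "norm x = norm w" by (simp add: w_def)
  then obtain f where f: "orthogonal_transformation f" "f x = w"
    by (rule orthogonal_transformation_exists)
  define A where "A = matrix f"
  have A: "A *v y = f y" for y
    using f(1) by (simp add: A_def orthogonal_transformation_linear matrix_works)
  \<comment> \<open>\<open>A\<close> preserves inner products and sends \<open>x\<close> to
    \<open>w\<close>, so it intertwines the two matrices. Taking determinants then requires only
    \<open>det A \<noteq> 0\<close>, not an inverse of \<open>A\<close>.\<close>
  have "A ** scalar_plus_rank_one c b x = scalar_plus_rank_one c b w ** A"
  proof (rule iffD2 [OF matrix_eq], rule allI)
    fix y
    have "x \<bullet> y = w \<bullet> f y"
      using f by (auto simp: orthogonal_transformation_def)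
    then show "A ** scalar_plus_rank_one c b x *v y = scalar_plus_rank_one c b w ** A *v y"
      using f(2) orthogonal_transformation_linear [OF f(1)]
      by (simp add: matrix_vector_mul_assoc [symmetric] scalar_plus_rank_one_vector_mult A
          linear_add linear_cmul)
  qed
  then have "det A * det (scalar_plus_rank_one c b x) = det (scalar_plus_rank_one c b w) * det A"
    by (metis det_mul)
  moreover have "det A \<noteq> 0"
    using f(1) det_orthogonal_matrix [of A]
    by (auto simp: A_def orthogonal_transformation_matrix)
  ultimately have "det (scalar_plus_rank_one c b x) = det (scalar_plus_rank_one c b w)"
    by simp
  also have "\<dots> = (\<Prod>i\<in>UNIV. scalar_plus_rank_one c b w $ i $ i)"
    by (rule det_diagonal) (auto simp: scalar_plus_rank_one_def w_def axis_def)
  also have "\<dots> = (\<Prod>i\<in>UNIV. if i = k then c + b * (x \<bullet> x) else c)"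
    by (rule prod.cong)
       (auto simp: scalar_plus_rank_one_def w_def axis_def dot_square_norm power2_eq_square)
  also have "\<dots> = (c + b * (x \<bullet> x)) * c ^ (CARD('n) - 1)"
    by (subst prod.remove [of _ k]) auto
  finally show ?thesis by simp
qed

section \<open>Characteristic polynomial, eigenvalues and their symmetric functions\<close>

lemma poly_charpoly:
  "poly (charpoly A) z = det (\<chi> i j. (if i = j then z else 0) - A $ i $ j)"
  unfolding charpoly_def det_def
  by (simp add: poly_sum poly_prod poly_mult of_int_poly if_distrib [of "\<lambda>p. poly p z"] cong: if_cong)

text \<open>A real polynomial is determined by its values, and at \<open>z\<close> the value is the
  determinant above with parameters \<open>z - a\<close> and \<open>- b\<close>.\<close>

lemma charpoly_scalar_plus_rank_one:
  fixes x :: "real ^ 'n"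
  shows "charpoly (scalar_plus_rank_one a b x)
    = [:- a, 1:] ^ (CARD('n) - 1) * [:- (a + b * (x \<bullet> x)), 1:]"
proof -
  have "poly (charpoly (scalar_plus_rank_one a b x)) z
      = poly ([:- a, 1:] ^ (CARD('n) - 1) * [:- (a + b * (x \<bullet> x)), 1:]) z" for z
  proof -
    have "(\<chi> i j. (if i = j then z else 0) - scalar_plus_rank_one a b x $ i $ j)
        = scalar_plus_rank_one (z - a) (- b) x"
      by (auto simp: scalar_plus_rank_one_def vec_eq_iff)
    then show ?thesis
      by (simp add: poly_charpoly det_scalar_plus_rank_one poly_power algebra_simps)
  qed
  then show ?thesis
    by (simp add: poly_eq_poly_eq_iff [symmetric] fun_eq_iff)
qed

text \<open>A multiset is used because the position of the exceptional eigenvalue in the sorted list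
  depends on the sign of \<open>b\<close>.\<close>

lemma mset_eigenvalues_scalar_plus_rank_one:
  fixes x :: "real ^ 'n"
  shows "mset (eigenvalues (scalar_plus_rank_one a b x))
    = add_mset (a + b * (x \<bullet> x)) (replicate_mset (CARD('n) - 1) a)"
proof -
  have "proots ([:- a, 1:] ^ (CARD('n) - 1) * [:- (a + b * (x \<bullet> x)), 1:])
      = proots ([:- a, 1:] ^ (CARD('n) - 1)) + proots [:- (a + b * (x \<bullet> x)), 1:]"
    by (rule proots_mult) auto
  also have "\<dots> = add_mset (a + b * (x \<bullet> x)) (replicate_mset (CARD('n) - 1) a)"
    by (simp add: proots_power repeat_mset_replicate_mset [of _ 1, simplified])
  finally show ?thesis
    by (simp add: eigenvalues_def charpoly_scalar_plus_rank_one)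
qed

text \<open>Fix one position \<open>j\<close> holding \<open>\<mu>\<close>. The index sets
  containing \<open>j\<close> produce the first term, the others the second.\<close>

lemma S_k_eq_if_mset_eigenvalues:
  fixes A :: "real ^ 'n ^ 'n"
  assumes "mset (eigenvalues A) = add_mset \<mu> (replicate_mset m \<nu>)" and k: "k > 0"
  shows "S_k k A = real (m choose (k - 1)) * \<nu> ^ (k - 1) * \<mu> + real (m choose k) * \<nu> ^ k"
proof -
  define l where "l = eigenvalues A"
  have ms: "mset l = add_mset \<mu> (replicate_mset m \<nu>)" using assms by (simp add: l_def)
  then have "\<mu> \<in> set l" by (metis set_mset_mset union_single_eq_member)
  then obtain xs ys where l: "l = xs @ \<mu> # ys" by (meson split_list)
  have xy: "mset (xs @ ys) = replicate_mset m \<nu>" using ms l by simp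
  have lam: "y = \<nu>" if "y \<in> set (xs @ ys)" for y
    using that xy by (metis in_replicate_mset set_mset_mset)
  define j where "j = length xs"
  have len: "length l = Suc m"
    using arg_cong [OF ms, of size] by simp
  have j: "j < Suc m" using l len by (simp add: j_def)
  have lj: "l ! j = \<mu>" by (simp add: l j_def)
  have li: "l ! i = \<nu>" if "i < Suc m" "i \<noteq> j" for i
  proof (cases "i < j")
    case True
    then show ?thesis using lam by (auto simp: l j_def nth_append)
  next
    case False
    then have "i = Suc (j + (i - Suc j))" using that by simp
    then obtain d where "i = Suc (j + d)" ..
    then have "l ! i = ys ! d" "d < length ys"
      using that len by (auto simp: l j_def nth_append)
    then show ?thesis using lam by auto
  qed
  define J where "J = {..<Suc m} - {j}"
  have J: "finite J" "card J = m" "j \<notin> J" "{..<Suc m} = insert j J"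
    using j by (auto simp: J_def)
  have prodJ: "(\<Prod>i\<in>I. l ! i) = \<nu> ^ card I" if "I \<subseteq> J" for I
    using that li by (subst prod.cong [of I I _ "\<lambda>_. \<nu>"]) (auto simp: J_def)
  let ?P = "\<lambda>q. {I. I \<subseteq> J \<and> card I = q}"
  have fin: "finite (?P q)" for q using J(1) by simp
  have split: "{I. I \<subseteq> {..<Suc m} \<and> card I = k} = insert j ` ?P (k - 1) \<union> ?P k"
  proof (intro equalityI subsetI)
    fix I assume "I \<in> {I. I \<subseteq> {..<Suc m} \<and> card I = k}"
    then have I: "I \<subseteq> insert j J" "card I = k" using J(4) by auto
    show "I \<in> insert j ` ?P (k - 1) \<union> ?P k"
    proof (cases "j \<in> I")
      case True
      then have "I = insert j (I - {j})" "I - {j} \<in> ?P (k - 1)"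
        using I J(1) finite_subset [OF I(1)] by auto
      then show ?thesis by blast
    qed (use I in auto)
  next
    fix I assume "I \<in> insert j ` ?P (k - 1) \<union> ?P k"
    then show "I \<in> {I. I \<subseteq> {..<Suc m} \<and> card I = k}"
    proof
      assume "I \<in> insert j ` ?P (k - 1)"
      then obtain I' where "I = insert j I'" "I' \<subseteq> J" "card I' = k - 1" by auto
      moreover have "finite I'" "j \<notin> I'"
        using calculation J finite_subset by blast+
      ultimately show ?thesis using J(4) k by auto
    qed (use J(4) in auto)
  qed
  have inj: "inj_on (insert j) (?P (k - 1))"
    using J(3) by (auto simp: inj_on_def)
  have "S_k k A = (\<Sum>I \<in> insert j ` ?P (k - 1) \<union> ?P k. \<Prod>i\<in>I. l ! i)"
    unfolding S_k_def l_def [symmetric] len split ..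
  also have "\<dots> = (\<Sum>I \<in> insert j ` ?P (k - 1). \<Prod>i\<in>I. l ! i) + (\<Sum>I \<in> ?P k. \<Prod>i\<in>I. l ! i)"
    using J(3) fin by (intro sum.union_disjoint) auto
  also have "(\<Sum>I \<in> ?P k. \<Prod>i\<in>I. l ! i) = (\<Sum>I \<in> ?P k. \<nu> ^ k)"
    using prodJ by (intro sum.cong) auto
  also have "\<dots> = real (m choose k) * \<nu> ^ k"
    using n_subsets [OF J(1), of k] J(2) by simp
  also have "(\<Sum>I \<in> insert j ` ?P (k - 1). \<Prod>i\<in>I. l ! i) = (\<Sum>I \<in> ?P (k - 1). \<Prod>i\<in>insert j I. l ! i)"
    using inj by (simp add: sum.reindex)
  also have "\<dots> = (\<Sum>I \<in> ?P (k - 1). \<mu> * \<nu> ^ (k - 1))"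
  proof (intro sum.cong refl)
    fix I assume "I \<in> ?P (k - 1)"
    moreover then have "finite I" "j \<notin> I" using J finite_subset by blast+
    ultimately show "(\<Prod>i\<in>insert j I. l ! i) = \<mu> * \<nu> ^ (k - 1)"
      using prodJ lj by auto
  qed
  also have "\<dots> = real (m choose (k - 1)) * \<nu> ^ (k - 1) * \<mu>"
    using n_subsets [OF J(1), of "k - 1"] J(2) by simp
  finally show ?thesis .
qed

text \<open>Pascal's rule merges the two multiples of \<open>a ^ k\<close>, which isolates the part
  that depends on \<open>x\<close>.\<close>

lemma S_k_scalar_plus_rank_one:
  fixes x :: "real ^ 'n"
  assumes "k > 0"
  shows "S_k k (scalar_plus_rank_one a b x)
    = real (CARD('n) choose k) * a ^ k
      + real ((CARD('n) - 1) choose (k - 1)) * a ^ (k - 1) * (b * (x \<bullet> x))"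
proof -
  obtain m where m: "CARD('n) = Suc m" using zero_less_card_finite not0_implies_Suc by force
  obtain q where q: "k = Suc q" using assms not0_implies_Suc by auto
  show ?thesis
    using S_k_eq_if_mset_eigenvalues [OF mset_eigenvalues_scalar_plus_rank_one assms, of a b x]
    by (simp add: m q algebra_simps)
qed

section \<open>Smooth functions\<close>

text \<open>On an open set a derivative depends only on nearby values, so equality of functions
  passes to their derivatives; the induction therefore varies both functions.\<close>

lemma C_diff_on_cong:
  assumes "open S" "C_diff_on m S f" "\<And>x. x \<in> S \<Longrightarrow> f x = g x"
  shows "C_diff_on m S g"
  using assms(2,3)
proof (induction m arbitrary: f g)
  case 0
  have "continuous_on S f" using "0.prems"(1) by simp
  then have "continuous_on S g"
    using "0.prems"(2) by (rule continuous_on_eq)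
  then show ?case by simp
next
  case (Suc m)
  have diff: "f differentiable (at x)" if "x \<in> S" for x
    using Suc.prems(1) that by simp
  have "g differentiable (at x)" if "x \<in> S" for x
  proof -
    have "(g has_derivative frechet_derivative f (at x)) (at x)"
      using diff [OF that, THEN frechet_derivative_works [THEN iffD1]] assms(1) that
      by (rule has_derivative_transform_within_open) (rule Suc.prems(2))
    then show ?thesis by (rule differentiableI)
  qed
  moreover have "C_diff_on m S (\<lambda>x. frechet_derivative g (at x) v)" for v
  proof (rule Suc.IH)
    show "C_diff_on m S (\<lambda>x. frechet_derivative f (at x) v)"
      using Suc.prems(1) by simp
    show "frechet_derivative f (at x) v = frechet_derivative g (at x) v" if "x \<in> S" for x
      using frechet_derivative_transform_within_open [OF diff [OF that] assms(1) that Suc.prems(2)]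
      by simp
  qed
  ultimately show ?case by simp
qed

text \<open>Lets the regions inside and outside the front be treated by different formulas and then
  joined.\<close>

lemma C_diff_on_Un:
  assumes "open S" "open T" "C_diff_on m S f" "C_diff_on m T f"
  shows "C_diff_on m (S \<union> T) f"
  using assms(3,4)
proof (induction m arbitrary: f)
  case 0
  then show ?case using assms(1,2) by (simp add: continuous_on_open_Un)
next
  case (Suc m)
  have "C_diff_on m (S \<union> T) (\<lambda>x. frechet_derivative f (at x) v)" for v
    using Suc.prems by (intro Suc.IH) auto
  then show ?case using Suc.prems by auto
qed

text \<open>Replaces \<open>frechet_derivative\<close> by an explicit derivative \<open>D\<close>,
  which is how the rules for sums, products and powers are proved.\<close>

lemma C_diff_on_SucI:
  assumes "open S" and "\<And>x. x \<in> S \<Longrightarrow> (f has_derivative D x) (at x)"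
    and "\<And>v. C_diff_on m S (\<lambda>x. D x v)"
  shows "C_diff_on (Suc m) S f"
proof -
  have "D x = frechet_derivative f (at x)" if "x \<in> S" for x
    using assms(2) [OF that] by (rule frechet_derivative_at)
  then have "C_diff_on m S (\<lambda>x. frechet_derivative f (at x) v)" for v
    by (intro C_diff_on_cong [OF assms(1) assms(3) [of v]]) simp
  moreover have "f differentiable (at x)" if "x \<in> S" for x
    using assms(2) [OF that] by (rule differentiableI)
  ultimately show ?thesis by simp
qed

lemma has_derivative_if_C_diff_on:
  "C_diff_on (Suc m) S f \<Longrightarrow> x \<in> S \<Longrightarrow> (f has_derivative frechet_derivative f (at x)) (at x)"
  by (rule frechet_derivative_works [THEN iffD1]) simp

text \<open>The product and power rules reuse the undifferentiated function one order lower. At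
  order zero, continuity comes from differentiability.\<close>

lemma C_diff_on_Suc_imp: "C_diff_on (Suc m) S f \<Longrightarrow> C_diff_on m S f"
proof (induction m arbitrary: f)
  case 0
  then have "continuous (at x) f" if "x \<in> S" for x
    using that differentiable_imp_continuous_within by auto
  then show ?case by (auto intro: continuous_at_imp_continuous_on)
next
  case (Suc m)
  from Suc.prems have d: "f differentiable (at x)" if "x \<in> S" for x
    using that unfolding C_diff_on.simps(2) [of "Suc m"] by blast
  from Suc.prems have "C_diff_on (Suc m) S (\<lambda>x. frechet_derivative f (at x) v)" for v
    unfolding C_diff_on.simps(2) [of "Suc m"] by blast
  then have "C_diff_on m S (\<lambda>x. frechet_derivative f (at x) v)" for v
    by (rule Suc.IH)
  with d show ?case unfolding C_diff_on.simps(2) by blast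
qed

section \<open>Closure rules for the differentiability classes\<close>

lemma C_diff_on_const: "C_diff_on m S (\<lambda>x. c)"
  by (induction m arbitrary: c) simp_all

lemma C_diff_on_bounded_linear:
  assumes "open S" "bounded_linear f"
  shows "C_diff_on m S f"
proof (cases m)
  case 0
  then show ?thesis using assms(2) by (simp add: linear_continuous_on)
next
  case (Suc q)
  show ?thesis unfolding Suc
  proof (rule C_diff_on_SucI [OF assms(1)])
    show "(f has_derivative f) (at x)" for x
      using assms(2) by (rule bounded_linear_imp_has_derivative)
    show "C_diff_on q S (\<lambda>x. f v)" for v
      by (rule C_diff_on_const)
  qed
qed

lemma C_diff_on_add:
  assumes "open S" "C_diff_on m S f" "C_diff_on m S g"
  shows "C_diff_on m S (\<lambda>x. f x + g x)"
  using assms(2,3)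
proof (induction m arbitrary: f g)
  case 0
  then show ?case by (simp add: continuous_on_add)
next
  case (Suc m)
  show ?case
  proof (rule C_diff_on_SucI [OF assms(1)])
    show "((\<lambda>x. f x + g x) has_derivative
        (\<lambda>v. frechet_derivative f (at x) v + frechet_derivative g (at x) v)) (at x)"
      if "x \<in> S" for x
      using that Suc.prems by (intro has_derivative_add has_derivative_if_C_diff_on)
  qed (use Suc in auto)
qed

lemma C_diff_on_mult:
  assumes "open S" "C_diff_on m S f" "C_diff_on m S g"
  shows "C_diff_on m S (\<lambda>x. f x * g x)"
  using assms(2,3)
proof (induction m arbitrary: f g)
  case 0
  then show ?case by (simp add: continuous_on_mult)
next
  case (Suc m)
  show ?case
  proof (rule C_diff_on_SucI [OF assms(1)])
    show "((\<lambda>x. f x * g x) has_derivative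
        (\<lambda>v. f x * frechet_derivative g (at x) v + frechet_derivative f (at x) v * g x)) (at x)"
      if "x \<in> S" for x
      using that Suc.prems by (intro has_derivative_mult has_derivative_if_C_diff_on)
    show "C_diff_on m S (\<lambda>x. f x * frechet_derivative g (at x) v + frechet_derivative f (at x) v * g x)"
      for v
      using Suc.prems C_diff_on_Suc_imp [OF Suc.prems(1)] C_diff_on_Suc_imp [OF Suc.prems(2)]
      by (intro C_diff_on_add [OF assms(1)] Suc.IH) auto
  qed
qed

text \<open>The induction covers all exponents at once, since differentiation replaces
  \<open>a\<close> by \<open>a - 1\<close>; the base being positive keeps every real exponent
  admissible.\<close>

lemma C_diff_on_powr:
  fixes f :: "'a::euclidean_space \<Rightarrow> real"
  assumes "open S" "C_diff_on m S f" "\<And>x. x \<in> S \<Longrightarrow> f x > 0"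
  shows "C_diff_on m S (\<lambda>x. f x powr a)"
  using assms(2)
proof (induction m arbitrary: a)
  case 0
  then show ?case
    using assms(3) by (auto intro!: continuous_on_powr simp: less_imp_neq [THEN not_sym])
next
  case (Suc m)
  show ?case
  proof (rule C_diff_on_SucI [OF assms(1)])
    show "((\<lambda>x. f x powr a) has_derivative
        (\<lambda>v. (a * f x powr (a - 1)) * frechet_derivative f (at x) v)) (at x)"
      if "x \<in> S" for x
    proof -
      have "((\<lambda>y. y powr a) has_field_derivative a * f x powr (a - 1)) (at (f x))"
        using assms(3) [OF that] by (intro has_real_derivative_powr)
      then have "((\<lambda>y. y powr a) has_derivative (*) (a * f x powr (a - 1))) (at (f x))"
        by (simp add: has_field_derivative_def)
      from diff_chain_at [OF has_derivative_if_C_diff_on [OF Suc.prems that] this]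
      show ?thesis by (simp add: o_def)
    qed
    show "C_diff_on m S (\<lambda>x. (a * f x powr (a - 1)) * frechet_derivative f (at x) v)" for v
      using Suc.prems C_diff_on_Suc_imp [OF Suc.prems]
      by (intro C_diff_on_mult [OF assms(1)] C_diff_on_const Suc.IH) auto
  qed
qed

text \<open>The derivative in a fixed direction \<open>v\<close> is linear in \<open>x\<close>,
  which reduces to the bounded linear case. With \<open>f = snd\<close> this is the squared space
  variable.\<close>

lemma C_diff_on_inner_self:
  fixes f :: "'a::euclidean_space \<Rightarrow> 'b::real_inner"
  assumes "open S" "bounded_linear f"
  shows "C_diff_on m S (\<lambda>x. f x \<bullet> f x)"
proof (cases m)
  case 0
  then show ?thesis using assms(2) by (auto intro: continuous_intros linear_continuous_on)
next
  case (Suc q)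
  interpret bounded_linear f by fact
  show ?thesis unfolding Suc
  proof (rule C_diff_on_SucI [OF assms(1)])
    show "((\<lambda>x. f x \<bullet> f x) has_derivative (\<lambda>v. f x \<bullet> f v + f v \<bullet> f x)) (at x)" for x
      by (intro has_derivative_inner bounded_linear_imp_has_derivative assms(2))
    show "C_diff_on q S (\<lambda>x. f x \<bullet> f v + f v \<bullet> f x)" for v
      by (intro C_diff_on_bounded_linear assms(1) bounded_linear_add
          bounded_linear_inner_left_comp bounded_linear_inner_right_comp assms(2))
  qed
qed

section \<open>Hessians and the structural constants\<close>

text \<open>The derivative of a slice at 0 only sees \<open>f\<close> near \<open>x\<close>, so a
  formula \<open>g\<close> valid on a neighbourhood suffices. For Hessians this is applied once to
  the function and once to its partial derivative.\<close>

lemma partial_deriv_eqI: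
  assumes W: "open W" "x \<in> W" "\<And>y. y \<in> W \<Longrightarrow> f y = g y"
    and D: "((\<lambda>s. g (x + s *\<^sub>R axis i 1)) has_real_derivative D) (at 0)"
  shows "partial_deriv i f x = D"
proof -
  let ?V = "(\<lambda>s. x + s *\<^sub>R axis i 1) -` W"
  have "open ?V"
    by (intro open_vimage W(1) continuous_intros)
  have "((\<lambda>s. f (x + s *\<^sub>R axis i 1)) has_real_derivative D) (at 0)"
    by (rule has_field_derivative_transform_within_open [OF D \<open>open ?V\<close>]) (use W in auto)
  then show ?thesis
    unfolding partial_deriv_def by (rule DERIV_imp_deriv)
qed

lemma hessian_eq_0_if_vanishing:
  fixes f :: "real ^ 'n \<Rightarrow> real"
  assumes W: "open W" "x \<in> W" "\<And>y. y \<in> W \<Longrightarrow> f y = 0"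
  shows "hessian f x = 0"
proof -
  have 1: "partial_deriv j f y = 0" if "y \<in> W" for j y
    by (rule partial_deriv_eqI [OF W(1) that, of f "\<lambda>_. 0"]) (auto simp: W(3))
  have "partial_deriv i (partial_deriv j f) x = 0" for i j
    by (rule partial_deriv_eqI [OF W(1,2), of _ "\<lambda>_. 0"]) (auto simp: 1)
  then show ?thesis by (simp add: hessian_def vec_eq_iff)
qed

text \<open>In the second differentiation, the factor \<open>y $ j\<close> contributes the scalar
  part and the power of \<open>w\<close> the rank-one part. The formula for \<open>f\<close> is
  assumed only where \<open>w\<close> is positive, to allow for a positive part.\<close>

lemma hessian_power_of_paraboloid:
  fixes f :: "real ^ 'n \<Rightarrow> real" and A C \<kappa> p :: real
  defines "w \<equiv> \<lambda>y::real ^ 'n. C - \<kappa> * (y \<bullet> y)"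
  assumes f: "\<And>y. 0 < w y \<Longrightarrow> f y = A * w y powr p" and x: "0 < w x"
  shows "hessian f x = scalar_plus_rank_one (- 2 * A * \<kappa> * p * w x powr (p - 1))
    (4 * A * \<kappa>\<^sup>2 * p * (p - 1) * w x powr (p - 2)) x"
proof -
  have W: "open {y. 0 < w y}"
    unfolding w_def by (intro open_Collect_less continuous_intros)
  \<comment> \<open>Along a coordinate line \<open>w\<close> is an exact quadratic in
    \<open>s\<close>, so one-variable calculus is enough.\<close>
  have shift: "w (y + s *\<^sub>R axis j 1) = w y - \<kappa> * (2 * s * y $ j + s\<^sup>2)" for y s j
    by (simp add: w_def inner_add_left inner_add_right inner_axis inner_axis' power2_eq_square algebra_simps)
  have 1: "partial_deriv j f y = - 2 * A * \<kappa> * p * w y powr (p - 1) * y $ j" if "0 < w y" for j y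
  proof (rule partial_deriv_eqI [OF W])
    have "((\<lambda>s. A * (w y - \<kappa> * (2 * s * y $ j + s\<^sup>2)) powr p) has_real_derivative
        A * (p * w y powr (p - 1) * (- (\<kappa> * (2 * y $ j))))) (at 0)"
      by (rule derivative_eq_intros refl | use that in simp)+
    then show "((\<lambda>s. A * w (y + s *\<^sub>R axis j 1) powr p) has_real_derivative
        - 2 * A * \<kappa> * p * w y powr (p - 1) * y $ j) (at 0)"
      unfolding shift by (simp add: algebra_simps)
  qed (use that f in auto)
  have "partial_deriv i (partial_deriv j f) x
      = (if i = j then - 2 * A * \<kappa> * p * w x powr (p - 1) else 0)
        + 4 * A * \<kappa>\<^sup>2 * p * (p - 1) * w x powr (p - 2) * x $ i * x $ j" for i j
  proof (rule partial_deriv_eqI [OF W])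
    \<comment> \<open>The Kronecker delta, the derivative of the \<open>j\<close>-th coordinate in
      direction \<open>i\<close>.\<close>
    define d :: real where "d = (if i = j then 1 else 0)"
    have coord: "(x + s *\<^sub>R axis i 1) $ j = x $ j + s * d" for s
      by (simp add: d_def axis_def)
    have "((\<lambda>s. - 2 * A * \<kappa> * p * ((w x - \<kappa> * (2 * s * x $ i + s\<^sup>2)) powr (p - 1)
          * (x $ j + s * d))) has_real_derivative
        - 2 * A * \<kappa> * p * (((p - 1) * w x powr (p - 1 - 1) * (- (\<kappa> * (2 * x $ i)))) * x $ j
          + w x powr (p - 1) * d)) (at 0)"
      by (rule derivative_eq_intros refl | use x in simp)+
    from this [unfolded mult.assoc] show "((\<lambda>s. - 2 * A * \<kappa> * p * w (x + s *\<^sub>R axis i 1) powr (p - 1)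
          * (x + s *\<^sub>R axis i 1) $ j) has_real_derivative
        (if i = j then - 2 * A * \<kappa> * p * w x powr (p - 1) else 0)
        + 4 * A * \<kappa>\<^sup>2 * p * (p - 1) * w x powr (p - 2) * x $ i * x $ j) (at 0)"
      unfolding shift coord mult.assoc
      by (rule DERIV_cong) (simp add: d_def algebra_simps power2_eq_square)
  qed (use x 1 in auto)
  then show ?thesis
    by (simp add: hessian_def scalar_plus_rank_one_def vec_eq_iff)
qed

section \<open>Identities for the exponents and constants, and the radius of the front\<close>

context
  fixes n k :: nat
  assumes nk: "2 \<le> n" "2 \<le> k" "k \<le> n"
begin

lemma denominator_pos: "real n * (real k - 1) + 2 * real k > 0"
  using nk by (intro add_nonneg_pos mult_nonneg_nonneg) auto

lemma beta_exp_pos: "beta_exp n k > 0"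
  using denominator_pos by (simp add: beta_exp_def)

lemma alpha_exp_eq: "alpha_exp n k = real n * beta_exp n k"
  by (simp add: alpha_exp_def beta_exp_def)

text \<open>Each second derivative carries the time power \<open>- \<alpha> - 2 \<beta>\<close>, and
  \<open>S_k\<close> multiplies \<open>k\<close> of them; the time derivative carries
  \<open>- \<alpha> - 1\<close>.\<close>

lemma exponent_balance: "(alpha_exp n k + 2 * beta_exp n k) * real k = alpha_exp n k + 1"
  using denominator_pos by (simp add: alpha_exp_def beta_exp_def divide_simps) (simp add: algebra_simps)

lemma c_const_pos: "c_const n k > 0"
  using nk by (simp add: c_const_def zero_less_binomial)

lemma gamma_const_pos: "gamma_const n k > 0"
  using nk beta_exp_pos c_const_pos by (simp add: gamma_const_def)

text \<open>This relation is the reason for the value of \<open>gamma_const\<close>: up to sign, the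
  base of the power is the constant factor of the repeated Hessian eigenvalue.\<close>

lemma gamma_const_powr:
  "(2 * (real k / (real k - 1)) * gamma_const n k) ^ k = beta_exp n k / c_const n k"
proof -
  have "2 * (real k / (real k - 1)) * gamma_const n k = (beta_exp n k / c_const n k) powr (1 / real k)"
    using nk by (simp add: gamma_const_def)
  then show ?thesis
    using beta_exp_pos c_const_pos nk by (simp add: powr_realpow [symmetric] powr_powr)
qed

text \<open>The constant multiplying \<open>C\<close> in \<open>front_radius\<close> is the
  reciprocal of \<open>gamma_const\<close>, so the front is where the base of the power
  vanishes.\<close>

lemma front_radius_eq:
  "front_radius n k C t = t powr beta_exp n k * sqrt (C / gamma_const n k)"
proof -
  have "(c_const n k / beta_exp n k) powr (1 / real k)
      = inverse ((beta_exp n k / c_const n k) powr (1 / real k))"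
    using beta_exp_pos c_const_pos by (simp add: powr_divide)
  then have "2 * real k / (real k - 1) * (c_const n k / beta_exp n k) powr (1 / real k)
      = 1 / gamma_const n k"
    unfolding gamma_const_def by (simp add: inverse_eq_divide)
  then show ?thesis by (simp add: front_radius_def)
qed

lemma norm_front_radius_iff:
  fixes x :: "'a::real_normed_vector"
  assumes "C > 0" "t > 0"
  shows "norm x < front_radius n k C t \<longleftrightarrow> 0 < C - gamma_const n k * (norm x / t powr beta_exp n k)\<^sup>2"
    and "norm x > front_radius n k C t \<longleftrightarrow> C - gamma_const n k * (norm x / t powr beta_exp n k)\<^sup>2 < 0"
proof -
  define q where "q = norm x / t powr beta_exp n k"
  have q: "q \<ge> 0" by (simp add: q_def)
  have "norm x < front_radius n k C t \<longleftrightarrow> q < sqrt (C / gamma_const n k)"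
    using assms by (simp add: front_radius_eq q_def divide_simps mult.commute)
  also have "\<dots> \<longleftrightarrow> q\<^sup>2 < C / gamma_const n k"
    using q by (metis real_sqrt_less_iff real_sqrt_unique)
  also have "\<dots> \<longleftrightarrow> 0 < C - gamma_const n k * q\<^sup>2"
    using gamma_const_pos by (simp add: field_simps)
  finally show "norm x < front_radius n k C t \<longleftrightarrow> 0 < C - gamma_const n k * (norm x / t powr beta_exp n k)\<^sup>2"
    by (simp add: q_def)
  have "norm x > front_radius n k C t \<longleftrightarrow> q > sqrt (C / gamma_const n k)"
    using assms by (simp add: front_radius_eq q_def divide_simps mult.commute)
  also have "\<dots> \<longleftrightarrow> q\<^sup>2 > C / gamma_const n k"
    using q by (metis real_sqrt_less_iff real_sqrt_unique)
  also have "\<dots> \<longleftrightarrow> C - gamma_const n k * q\<^sup>2 < 0"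
    using gamma_const_pos by (simp add: field_simps)
  finally show "norm x > front_radius n k C t \<longleftrightarrow> C - gamma_const n k * (norm x / t powr beta_exp n k)\<^sup>2 < 0"
    by (simp add: q_def)
qed

end

section \<open>The equation away from the front\<close>

text \<open>Removes the positive part and writes the squared norm as an inner product, which is
  smooth at the origin too.\<close>

lemma barenblatt_eq:
  fixes x :: "real ^ 'n"
  assumes nk: "2 \<le> CARD('n)" "2 \<le> k" "k \<le> CARD('n)" and "C > 0" "t > 0"
    and "norm x < front_radius CARD('n) k C t"
  shows "barenblatt k C t x = t powr (- alpha_exp CARD('n) k) *
    (C - gamma_const CARD('n) k * t powr (- 2 * beta_exp CARD('n) k) * (x \<bullet> x)) powr (real k / (real k - 1))"
    and "0 < C - gamma_const CARD('n) k * t powr (- 2 * beta_exp CARD('n) k) * (x \<bullet> x)"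
proof -
  have eq: "gamma_const CARD('n) k * (norm x / t powr beta_exp CARD('n) k)\<^sup>2
      = gamma_const CARD('n) k * t powr (- 2 * beta_exp CARD('n) k) * (x \<bullet> x)"
    using \<open>t > 0\<close>
    by (simp add: power_divide dot_square_norm powr_minus_divide powr_power mult.commute)
  then show pos: "0 < C - gamma_const CARD('n) k * t powr (- 2 * beta_exp CARD('n) k) * (x \<bullet> x)"
    using norm_front_radius_iff(1) [OF nk \<open>C > 0\<close> \<open>t > 0\<close>, of x] assms(6) by (simp only: eq)
  then show "barenblatt k C t x = t powr (- alpha_exp CARD('n) k) *
    (C - gamma_const CARD('n) k * t powr (- 2 * beta_exp CARD('n) k) * (x \<bullet> x)) powr (real k / (real k - 1))"
    unfolding barenblatt_def eq by simp
qed

lemma barenblatt_eq_0: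
  fixes x :: "real ^ 'n"
  assumes nk: "2 \<le> CARD('n)" "2 \<le> k" "k \<le> CARD('n)" and "C > 0" "t > 0"
    and "norm x > front_radius CARD('n) k C t"
  shows "barenblatt k C t x = 0"
  using norm_front_radius_iff(2) [OF nk \<open>C > 0\<close> \<open>t > 0\<close>, of x] assms(6)
  by (simp add: barenblatt_def)

lemma continuous_on_front_radius: "continuous_on {0<..} (front_radius n k C)"
  unfolding front_radius_def by (intro continuous_intros) auto

lemma open_space_time_regions:
  shows "open {z::real \<times> 'a::euclidean_space. 0 < fst z \<and> norm (snd z) < front_radius n k C (fst z)}"
    and "open {z::real \<times> 'a::euclidean_space. 0 < fst z \<and> norm (snd z) > front_radius n k C (fst z)}"
proof -
  define T where "T = {z::real \<times> 'a. 0 < fst z}"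
  have T: "open T" unfolding T_def by (intro open_Collect_less continuous_intros)
  have "continuous_on T (\<lambda>z. front_radius n k C (fst z))"
    by (rule continuous_on_compose2 [OF continuous_on_front_radius])
       (auto simp: T_def intro!: continuous_intros)
  then have cont: "continuous_on T (\<lambda>z. norm (snd z) - front_radius n k C (fst z))"
    by (intro continuous_intros)
  have "open (T \<inter> (\<lambda>z. norm (snd z) - front_radius n k C (fst z)) -` {..<0})"
    "open (T \<inter> (\<lambda>z. norm (snd z) - front_radius n k C (fst z)) -` {0<..})"
    by (intro continuous_open_preimage cont T; simp)+
  then show "open {z::real \<times> 'a. 0 < fst z \<and> norm (snd z) < front_radius n k C (fst z)}"
    "open {z::real \<times> 'a. 0 < fst z \<and> norm (snd z) > front_radius n k C (fst z)}"
    by (simp_all add: T_def vimage_def Int_def)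
qed

lemma smooth_on_barenblatt:
  assumes nk: "2 \<le> CARD('n)" "2 \<le> k" "k \<le> CARD('n)" and C: "C > 0"
  shows "smooth_on {(t, x). 0 < t \<and> norm x \<noteq> front_radius CARD('n) k C t}
    (\<lambda>(t, x :: real ^ 'n). barenblatt k C t x)"
  unfolding smooth_on_def
proof
  fix m
  let ?R = "front_radius CARD('n) k C"
  define S where "S = {z::real \<times> (real ^ 'n). 0 < fst z \<and> norm (snd z) < ?R (fst z)}"
  define T where "T = {z::real \<times> (real ^ 'n). 0 < fst z \<and> norm (snd z) > ?R (fst z)}"
  have S: "open S" and T: "open T"
    unfolding S_def T_def by (rule open_space_time_regions)+
  \<comment> \<open>Written with sums and products only, to match the closure rules.\<close>
  define w where "w = (\<lambda>z::real \<times> (real ^ 'n).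
    C + (- gamma_const CARD('n) k) * (fst z powr (- 2 * beta_exp CARD('n) k) * (snd z \<bullet> snd z)))"
  have t: "C_diff_on m S (\<lambda>z. fst z powr a)" for a
    by (rule C_diff_on_powr [OF S C_diff_on_bounded_linear [OF S bounded_linear_fst]])
       (simp add: S_def)
  have w_pos: "0 < w z" if "z \<in> S" for z
    using that barenblatt_eq(2) [OF nk C, of "fst z" "snd z"] by (simp add: S_def w_def mult.assoc)
  have "C_diff_on m S w"
    unfolding w_def
    by (intro C_diff_on_add C_diff_on_mult C_diff_on_const C_diff_on_inner_self t S bounded_linear_snd)
  then have "C_diff_on m S (\<lambda>z. fst z powr (- alpha_exp CARD('n) k) * w z powr (real k / (real k - 1)))"
    by (intro C_diff_on_mult C_diff_on_powr t S w_pos)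
  then have "C_diff_on m S (\<lambda>(t, x). barenblatt k C t x)"
    by (rule C_diff_on_cong [OF S])
       (auto simp: S_def w_def barenblatt_eq(1) [OF nk C] mult.assoc)
  moreover have "C_diff_on m T (\<lambda>(t, x). barenblatt k C t x)"
    by (rule C_diff_on_cong [OF T C_diff_on_const [of _ _ 0]])
       (auto simp: T_def barenblatt_eq_0 [OF nk C])
  ultimately have "C_diff_on m (S \<union> T) (\<lambda>(t, x). barenblatt k C t x)"
    by (rule C_diff_on_Un [OF S T])
  moreover have "S \<union> T = {(t, x). 0 < t \<and> norm x \<noteq> ?R t}"
    by (auto simp: S_def T_def)
  ultimately show "C_diff_on m {(t, x :: real ^ 'n). 0 < t \<and> norm x \<noteq> ?R t} (\<lambda>(t, x). barenblatt k C t x)"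
    by simp
qed

text \<open>Both sides are reduced to \<open>t powr (- a - 1) * X\<close> times a combination of
  \<open>w\<close> and \<open>r\<close>; these agree up to the sign supplied by the
  equation.\<close>

lemma barenblatt_equation_inside:
  fixes x :: "real ^ 'n"
  assumes nk: "2 \<le> CARD('n)" "2 \<le> k" "k \<le> CARD('n)" and C: "C > 0" and t: "t > 0"
    and x: "norm x < front_radius CARD('n) k C t"
  shows "deriv (\<lambda>s. barenblatt k C s x) t = (-1) ^ (k - 1) * S_k k (hessian (barenblatt k C t) x)"
proof -
  define n where "n = CARD('n)"
  define a where "a = alpha_exp n k"
  define b where "b = beta_exp n k"
  define c where "c = c_const n k"
  define g where "g = gamma_const n k"
  define p where "p = real k / (real k - 1)"
  define r where "r = x \<bullet> x"
  define W where "W = (\<lambda>s. C - g * s powr (- 2 * b) * r)"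
  define A where "A = t powr (- a)"
  define \<kappa> where "\<kappa> = g * t powr (- 2 * b)"
  define w where "w = W t"
  define X where "X = w powr (p - 1)"
  define \<nu> where "\<nu> = - 2 * A * \<kappa> * p * X"
  have nk': "2 \<le> n" "2 \<le> k" "k \<le> n" using nk by (auto simp: n_def)
  have w: "w > 0"
    using barenblatt_eq(2) [OF nk C t x] by (simp add: w_def W_def g_def b_def n_def r_def)
  have k1: "real k - 1 > 0" "p - 1 = 1 / (real k - 1)" using nk by (auto simp: p_def field_simps)
  have kp: "real k * (p - 1) = p" using k1 by (simp add: p_def)
  have Xw: "w powr p = w * X" "w powr (p - 2) = X / w"
    using w powr_add [of w 1 "p - 1"] powr_diff [of w "p - 1" 1] by (auto simp: X_def)
  have Xk1: "X ^ (k - 1) = w"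
    using w k1 nk by (simp add: X_def powr_power of_nat_diff)
  have Xk: "X ^ k = w * X"
    using Xk1 nk by (metis Suc_diff_1 mult.commute nat_less_le pos2 order_less_le_trans power_Suc)

  \<comment> \<open>The fixed point \<open>x\<close> stays inside the moving front for times near
    \<open>t\<close>, so the formula without positive part may be differentiated in time.\<close>
  have "{s. s > 0 \<and> norm x < front_radius n k C s} = {0<..} \<inter> (\<lambda>s. norm x - front_radius n k C s) -` {..<0}"
    by auto
  also have "open \<dots>"
    by (intro continuous_open_preimage continuous_intros continuous_on_front_radius)
  finally have opn: "open {s. s > 0 \<and> norm x < front_radius n k C s}" .
  have "(W has_real_derivative 2 * b * g * r * t powr (- 2 * b - 1)) (at t)"
    unfolding W_def by (rule derivative_eq_intros refl | use t in simp)+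
  from DERIV_chain2 [OF has_real_derivative_powr this] w
  have "((\<lambda>s. W s powr p) has_real_derivative
      (p * w powr (p - 1)) * (2 * b * g * r * t powr (- 2 * b - 1))) (at t)"
    by (simp add: w_def)
  from DERIV_mult [OF has_real_derivative_powr [OF t, of "- a"] this]
  have "((\<lambda>s. s powr (- a) * W s powr p) has_real_derivative
      (- a * t powr (- a - 1)) * w powr p
      + (p * w powr (p - 1) * (2 * b * g * r * t powr (- 2 * b - 1))) * t powr (- a)) (at t)"
    by (simp add: w_def)
  then have "((\<lambda>s. barenblatt k C s x) has_real_derivative
      (- a * t powr (- a - 1)) * w powr p
      + (p * w powr (p - 1) * (2 * b * g * r * t powr (- 2 * b - 1))) * t powr (- a)) (at t)"
    by (rule has_field_derivative_transform_within_open [OF _ opn])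
       (use t x barenblatt_eq(1) [OF nk C] in \<open>auto simp: W_def a_def b_def g_def n_def r_def p_def\<close>)
  then have "deriv (\<lambda>s. barenblatt k C s x) t = (- a * t powr (- a - 1)) * w powr p
      + (p * w powr (p - 1) * (2 * b * g * r * t powr (- 2 * b - 1))) * t powr (- a)"
    by (rule DERIV_imp_deriv)
  also have "\<dots> = t powr (- a - 1) * X * (2 * b * p * \<kappa> * r - a * w)"
  proof -
    have "t powr (- 2 * b - 1) * t powr (- a) = t powr (- a - 1) * t powr (- 2 * b)"
      by (simp add: powr_add [symmetric] algebra_simps)
    then show ?thesis
      by (simp add: Xw X_def [symmetric] \<kappa>_def algebra_simps)
  qed
  finally have lhs: "deriv (\<lambda>s. barenblatt k C s x) t = t powr (- a - 1) * X * (2 * b * p * \<kappa> * r - a * w)" .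

  have "hessian (barenblatt k C t) x = scalar_plus_rank_one (- 2 * A * \<kappa> * p * (C - \<kappa> * (x \<bullet> x)) powr (p - 1))
    (4 * A * \<kappa>\<^sup>2 * p * (p - 1) * (C - \<kappa> * (x \<bullet> x)) powr (p - 2)) x"
  proof (rule hessian_power_of_paraboloid)
    fix y :: "real ^ 'n"
    have eq: "gamma_const n k * (norm y / t powr b)\<^sup>2 = \<kappa> * (y \<bullet> y)"
      using t by (simp add: \<kappa>_def g_def power_divide dot_square_norm powr_minus_divide powr_power mult.commute)
    assume "0 < C - \<kappa> * (y \<bullet> y)"
    then show "barenblatt k C t y = A * (C - \<kappa> * (y \<bullet> y)) powr p"
      unfolding barenblatt_def n_def [symmetric] b_def [symmetric] eq by (simp add: A_def a_def p_def)
  next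
    show "0 < C - \<kappa> * (x \<bullet> x)" using w by (simp add: w_def W_def \<kappa>_def r_def)
  qed
  also have "C - \<kappa> * (x \<bullet> x) = w" by (simp add: w_def W_def \<kappa>_def r_def)
  finally have "S_k k (hessian (barenblatt k C t) x)
      = real (n choose k) * \<nu> ^ k
        + real ((n - 1) choose (k - 1)) * (\<nu> ^ (k - 1) * (4 * A * \<kappa>\<^sup>2 * p * (p - 1) * (X / w) * r))"
    using nk by (simp add: S_k_scalar_plus_rank_one n_def \<nu>_def X_def Xw(2) [unfolded X_def] r_def mult.assoc)
  \<comment> \<open>The coefficient of the rank-one part is a multiple of \<open>\<nu>\<close>, so
    \<open>\<nu> ^ k\<close> can be taken out of both terms.\<close>
  also have "\<nu> ^ (k - 1) * (4 * A * \<kappa>\<^sup>2 * p * (p - 1) * (X / w) * r)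
      = \<nu> ^ k * (- 2 * \<kappa> * (p - 1) * r / w)"
  proof -
    have "4 * A * \<kappa>\<^sup>2 * p * (p - 1) * (X / w) * r = \<nu> * (- 2 * \<kappa> * (p - 1) * r / w)"
      by (simp add: \<nu>_def power2_eq_square)
    moreover have "\<nu> ^ k = \<nu> ^ (k - 1) * \<nu>" using nk by (simp add: power_eq_if)
    ultimately show ?thesis by simp
  qed
  also have "real (n choose k) = n * c" using nk' by (simp add: c_def c_const_def)
  \<comment> \<open>The absorption identity expresses the second binomial coefficient through the
    same constant \<open>c\<close>.\<close>
  also have "real ((n - 1) choose (k - 1)) = k * c"
  proof -
    have "k * (n choose k) = n * ((n - 1) choose (k - 1))"
      using nk' by (metis Suc_diff_1 binomial_absorption nat_less_le order_less_le_trans pos2)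
    then have "real k * real (n choose k) = real n * real ((n - 1) choose (k - 1))"
      by (metis of_nat_mult)
    then show ?thesis using nk' by (simp add: c_def c_const_def field_simps)
  qed
  \<comment> \<open>Here the choice of \<open>\<gamma>\<close> gives \<open>b / c\<close>, the
    exponent balance gives the power of \<open>t\<close>, and \<open>X ^ (k - 1) = w\<close> gives
    \<open>w * X\<close>.\<close>
  also have "\<nu> ^ k = (- 1) ^ k * (b / c) * t powr (- a - 1) * (w * X)"
  proof -
    have "\<nu> = (- 1) * (2 * p * g) * t powr (- a - 2 * b) * X"
      by (simp add: \<nu>_def A_def \<kappa>_def powr_diff powr_minus divide_inverse mult_ac)
    moreover have "(t powr (- a - 2 * b)) ^ k = t powr (- a - 1)"
    proof -
      have "real k * (- a - 2 * b) = - a - 1"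
        using exponent_balance [OF nk'] by (simp add: a_def b_def algebra_simps)
      then show ?thesis using t by (simp add: powr_power)
    qed
    moreover have "(2 * p * g) ^ k = b / c"
      using gamma_const_powr [OF nk'] by (simp add: p_def g_def b_def c_def)
    ultimately show ?thesis by (simp only: power_mult_distrib Xk)
  qed
  also have "real n * c * ((- 1) ^ k * (b / c) * t powr (- a - 1) * (w * X))
      + real k * c * ((- 1) ^ k * (b / c) * t powr (- a - 1) * (w * X) * (- 2 * \<kappa> * (p - 1) * r / w))
      = (- 1) ^ k * t powr (- a - 1) * X * (n * b * w - 2 * b * (k * (p - 1)) * \<kappa> * r)"
    using w c_const_pos [OF nk'] by (simp add: c_def [symmetric] field_simps)
  \<comment> \<open>Uses \<open>k (p - 1) = p\<close> and \<open>a = n b\<close>.\<close>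
  also have "\<dots> = (- 1) ^ k * t powr (- a - 1) * X * (a * w - 2 * b * p * \<kappa> * r)"
    unfolding kp using alpha_exp_eq [OF nk'] by (simp add: a_def b_def)
  finally have rhs: "S_k k (hessian (barenblatt k C t) x)
      = (- 1) ^ k * t powr (- a - 1) * X * (a * w - 2 * b * p * \<kappa> * r)" .
  have "(- 1 :: real) ^ (k - 1) * (- 1) ^ k = - 1"
    using nk by (simp add: power_add [symmetric] uminus_power_if)
  then have "(- 1) ^ (k - 1) * S_k k (hessian (barenblatt k C t) x)
      = - 1 * (t powr (- a - 1) * X * (a * w - 2 * b * p * \<kappa> * r))"
    unfolding rhs by (simp only: mult.assoc [symmetric])
  with lhs show ?thesis by (simp add: algebra_simps)
qed

lemma barenblatt_equation_outside:
  fixes x :: "real ^ 'n"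
  assumes nk: "2 \<le> CARD('n)" "2 \<le> k" "k \<le> CARD('n)" and C: "C > 0" and t: "t > 0"
    and x: "norm x > front_radius CARD('n) k C t"
  shows "deriv (\<lambda>s. barenblatt k C s x) t = 0" and "S_k k (hessian (barenblatt k C t) x) = 0"
proof -
  let ?R = "front_radius CARD('n) k C"
  have "{s. s > 0 \<and> norm x > ?R s} = {0<..} \<inter> (\<lambda>s. norm x - ?R s) -` {0<..}"
    by auto
  also have "open \<dots>"
    by (intro continuous_open_preimage continuous_intros continuous_on_front_radius)
  finally have opn: "open {s. s > 0 \<and> norm x > ?R s}" .
  have "((\<lambda>s. barenblatt k C s x) has_real_derivative 0) (at t)"
    by (rule has_field_derivative_transform_within_open [OF DERIV_const [of 0] opn])
       (use t x barenblatt_eq_0 [OF nk C] in auto)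
  then show "deriv (\<lambda>s. barenblatt k C s x) t = 0"
    by (rule DERIV_imp_deriv)
  have "open {y::real ^ 'n. norm y > ?R t}"
    by (intro open_Collect_less continuous_intros)
  then have "hessian (barenblatt k C t) x = 0"
    by (rule hessian_eq_0_if_vanishing) (use x barenblatt_eq_0 [OF nk C t] in auto)
  \<comment> \<open>The zero matrix is a degenerate case, so the explicit formula for
    \<open>S_k\<close> applies.\<close>
  also have "0 = scalar_plus_rank_one 0 0 x"
    by (simp add: scalar_plus_rank_one_def vec_eq_iff)
  finally show "S_k k (hessian (barenblatt k C t) x) = 0"
    using nk by (simp add: S_k_scalar_plus_rank_one)
qed

section \<open>Mass and initial trace\<close>

lemma scale_measure_eq_density: "scale_measure r M = density M (\<lambda>_. r)"
  by (rule measure_eqI) (auto simp: emeasure_density nn_integral_cmult_indicator)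

lemma lborel_integral_scaleR:
  fixes f :: "'a::euclidean_space \<Rightarrow> real"
  assumes [measurable]: "f \<in> borel_measurable borel" and c: "c > 0"
  shows "(\<integral>x. f x \<partial>lborel) = c ^ DIM('a) * (\<integral>x. f (c *\<^sub>R x) \<partial>lborel)"
proof -
  have "(\<integral>x. f x \<partial>lborel)
      = (\<integral>x. f x \<partial>density (distr lborel borel (\<lambda>x. 0 + c *\<^sub>R x)) (\<lambda>_. ennreal (c ^ DIM('a))))"
    using c by (subst lborel_affine [of c 0]) (auto simp: ennreal_power)
  also have "\<dots> = c ^ DIM('a) * (\<integral>x. f (c *\<^sub>R x) \<partial>lborel)"
    using c by (subst integral_density) (auto simp: integral_distr)
  finally show ?thesis .
qed

text \<open>The prefactor cancels the Jacobian, so the dilation moves from \<open>\<theta>\<close>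
  to \<open>\<phi>\<close>. With \<open>\<phi> = 1\<close> this is mass conservation, with general
  \<open>\<phi>\<close> it prepares the initial trace.\<close>

lemma lborel_integral_self_similar:
  fixes \<phi> \<theta> :: "'a::euclidean_space \<Rightarrow> real"
  assumes [measurable]: "\<phi> \<in> borel_measurable borel" "\<theta> \<in> borel_measurable borel" and t: "t > 0"
  shows "(\<integral>x. (t powr (- (real DIM('a) * b)) * \<theta> (x /\<^sub>R t powr b)) * \<phi> x \<partial>lborel)
    = (\<integral>x. \<theta> x * \<phi> (t powr b *\<^sub>R x) \<partial>lborel)"
proof -
  have "(\<integral>x. (t powr (- (real DIM('a) * b)) * \<theta> (x /\<^sub>R t powr b)) * \<phi> x \<partial>lborel)
      = (t powr b) ^ DIM('a)
        * (\<integral>x. t powr (- (real DIM('a) * b)) * (\<theta> x * \<phi> (t powr b *\<^sub>R x)) \<partial>lborel)"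
    using t by (subst lborel_integral_scaleR [of _ "t powr b"]) (auto simp: mult.assoc)
  also have "\<dots> = ((t powr b) ^ DIM('a) * t powr (- (real DIM('a) * b)))
        * (\<integral>x. \<theta> x * \<phi> (t powr b *\<^sub>R x) \<partial>lborel)"
    by (simp only: mult.assoc integral_mult_right_zero)
  also have "(t powr b) ^ DIM('a) * t powr (- (real DIM('a) * b)) = 1"
    using t by (simp add: powr_power powr_add [symmetric] mult.commute)
  finally show ?thesis by simp
qed

lemma integrable_lborel_compact_support:
  fixes f :: "'a::euclidean_space \<Rightarrow> real"
  assumes "continuous_on UNIV f" "compact K" "\<And>x. x \<notin> K \<Longrightarrow> f x = 0"
  shows "integrable lborel f"
proof -
  have "integrable lborel (\<lambda>x. indicator K x *\<^sub>R f x)"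
    using assms by (intro borel_integrable_compact continuous_on_subset [OF assms(1)]) auto
  also have "(\<lambda>x. indicator K x *\<^sub>R f x) = f"
    by (rule ext) (use assms(3) in \<open>auto simp: indicator_def\<close>)
  finally show ?thesis .
qed

text \<open>Were the integral zero, \<open>f\<close> would vanish almost everywhere and the nonempty
  open set \<open>U\<close> would be negligible.\<close>

lemma lborel_integral_pos:
  fixes f :: "'a::euclidean_space \<Rightarrow> real"
  assumes f: "integrable lborel f" "\<And>x. 0 \<le> f x" and U: "open U" "U \<noteq> {}" "\<And>x. x \<in> U \<Longrightarrow> 0 < f x"
  shows "0 < (\<integral>x. f x \<partial>lborel)"
proof (rule ccontr)
  assume "\<not> 0 < (\<integral>x. f x \<partial>lborel)"
  then have "(\<integral>x. f x \<partial>lborel) = 0"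
    using Bochner_Integration.integral_nonneg [of lborel f] f(2) by (simp add: order_antisym not_less)
  then have "AE x in lborel. f x = 0"
    using integral_nonneg_eq_0_iff_AE [OF f(1)] f(2) by simp
  then have "AE x in lborel. x \<notin> U"
    by eventually_elim (use U(3) in force)
  then have "U \<in> null_sets lborel"
    using U(1) by (subst (asm) AE_iff_null_sets [symmetric]) auto
  then have "negligible U"
    by (simp add: negligible_iff_null_sets null_sets_completionI)
  then show False
    using open_not_negligible U(1,2) by blast
qed

text \<open>After the substitution \<open>x = t\<^sup>b y\<close> the test function is evaluated at \<open>t\<^sup>b y\<close>,
  which tends to \<open>0\<close>, and dominated convergence applies.\<close>

lemma measures_tendsto_self_similar:
  fixes \<theta> :: "'a::euclidean_space \<Rightarrow> real" and u :: "real \<Rightarrow> 'a \<Rightarrow> real"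
  assumes \<theta>: "integrable lborel \<theta>" "\<And>x. 0 \<le> \<theta> x" and b: "b > 0"
    and u: "\<And>t x. t > 0 \<Longrightarrow> u t x = t powr (- (real DIM('a) * b)) * \<theta> (x /\<^sub>R t powr b)"
  shows "measures_tendsto (\<lambda>t. density lborel (\<lambda>x. ennreal (u t x)))
    (scale_measure (ennreal (\<integral>x. \<theta> x \<partial>lborel)) (return borel 0)) (at_right 0)"
  unfolding measures_tendsto_def
proof (intro allI impI)
  fix \<phi> :: "'a \<Rightarrow> real"
  assume \<phi>: "continuous_on UNIV \<phi>" "bounded (range \<phi>)"
  from \<phi>(2) obtain B where B: "\<bar>\<phi> x\<bar> \<le> B" for x by (auto simp: bounded_real)
  have [measurable]: "\<phi> \<in> borel_measurable borel" "\<theta> \<in> borel_measurable borel"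
    using borel_measurable_continuous_onI [OF \<phi>(1)] borel_measurable_integrable [OF \<theta>(1)] by auto
  have integral_u: "(\<integral>x. \<phi> x \<partial>density lborel (\<lambda>x. ennreal (u t x)))
      = (\<integral>x. \<phi> (t powr b *\<^sub>R x) * \<theta> x \<partial>lborel)" if t: "t > 0" for t
  proof -
    have eq: "u t = (\<lambda>x. t powr (- (real DIM('a) * b)) * \<theta> (x /\<^sub>R t powr b))"
      using u [OF t] by (rule ext)
    then have [measurable]: "u t \<in> borel_measurable borel"
      by simp
    have "(\<integral>x. \<phi> x \<partial>density lborel (\<lambda>x. ennreal (u t x))) = (\<integral>x. u t x * \<phi> x \<partial>lborel)"
      using t \<theta>(2) by (subst integral_density) (auto simp: u [OF t])
    also have "\<dots> = (\<integral>x. \<theta> x * \<phi> (t powr b *\<^sub>R x) \<partial>lborel)"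
      unfolding eq using t by (intro lborel_integral_self_similar) simp_all
    finally show ?thesis by (simp add: mult.commute)
  qed
  \<comment> \<open>With \<open>s = 1 / t\<close> the limit at 0 from the right becomes one at
    infinity. A bound \<open>B\<close> for \<open>\<phi>\<close> gives the dominating function
    \<open>B * \<theta> x\<close>.\<close>
  have lim: "((\<lambda>s. \<integral>x. \<phi> (inverse s powr b *\<^sub>R x) * \<theta> x \<partial>lborel)
      \<longlongrightarrow> (\<integral>x. \<phi> 0 * \<theta> x \<partial>lborel)) at_top"
  proof (rule integral_dominated_convergence_at_top [where w = "\<lambda>x. B * \<theta> x"])
    have "((\<lambda>s. inverse s powr b) \<longlongrightarrow> 0) at_top"
      using b tendsto_inverse_0_at_top [OF filterlim_ident]
      by (auto intro!: tendsto_powr'[where b = b and a = 0, simplified] simp: eventually_at_top_linorder)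
    then have "((\<lambda>s. inverse s powr b *\<^sub>R x) \<longlongrightarrow> 0 *\<^sub>R x) at_top" for x :: 'a
      by (intro tendsto_intros)
    then have "((\<lambda>s. \<phi> (inverse s powr b *\<^sub>R x)) \<longlongrightarrow> \<phi> 0) at_top" for x
      using \<phi>(1) by (intro isCont_tendsto_compose [of _ \<phi>]) (auto simp: continuous_on_eq_continuous_at)
    then show "AE x in lborel. ((\<lambda>s. \<phi> (inverse s powr b *\<^sub>R x) * \<theta> x) \<longlongrightarrow> \<phi> 0 * \<theta> x) at_top"
      by (intro AE_I2 tendsto_intros)
    show "\<forall>\<^sub>F s in at_top. AE x in lborel. norm (\<phi> (inverse s powr b *\<^sub>R x) * \<theta> x) \<le> B * \<theta> x"
      using B \<theta>(2) by (auto simp: abs_mult intro!: always_eventually mult_right_mono)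
    show "integrable lborel (\<lambda>x. B * \<theta> x)" using \<theta>(1) by simp
  qed measurable
  have "(\<integral>x. \<phi> x \<partial>scale_measure (ennreal (\<integral>x. \<theta> x \<partial>lborel)) (return borel 0))
      = (\<integral>x. \<theta> x \<partial>lborel) * \<phi> 0"
    unfolding scale_measure_eq_density
    by (subst integral_density) (auto simp: \<theta>(2) integral_return)
  also have "\<dots> = (\<integral>x. \<phi> 0 * \<theta> x \<partial>lborel)" by simp
  finally have dirac: "(\<integral>x. \<phi> x \<partial>scale_measure (ennreal (\<integral>x. \<theta> x \<partial>lborel)) (return borel 0))
      = (\<integral>x. \<phi> 0 * \<theta> x \<partial>lborel)" .
  show "((\<lambda>t. \<integral>x. \<phi> x \<partial>density lborel (\<lambda>x. ennreal (u t x)))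
      \<longlongrightarrow> (\<integral>x. \<phi> x \<partial>scale_measure (ennreal (\<integral>x. \<theta> x \<partial>lborel)) (return borel 0))) (at_right 0)"
    unfolding dirac filterlim_at_right_to_top
    by (rule Lim_transform_eventually [OF lim], rule eventually_mono [OF eventually_gt_at_top [of 0]])
       (simp add: integral_u)
qed

section \<open>The profile at time 1 and the assembly of the theorem\<close>

lemma barenblatt_nonneg: "0 \<le> barenblatt k C t x"
  by (simp add: barenblatt_def)

lemma barenblatt_self_similar:
  fixes x :: "real ^ 'n"
  assumes "t > 0"
  shows "barenblatt k C t x = t powr (- alpha_exp CARD('n) k) *
    barenblatt k C 1 (x /\<^sub>R t powr beta_exp CARD('n) k)"
  using assms by (simp add: barenblatt_def divide_inverse mult.commute)

lemma continuous_on_barenblatt: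
  fixes k :: nat
  assumes "2 \<le> k" "t > 0"
  shows "continuous_on UNIV (barenblatt k C t :: real ^ 'n \<Rightarrow> real)"
proof -
  have p: "real k / (real k - 1) > 0" using assms(1) by simp
  \<comment> \<open>At \<open>y = 0\<close> continuity relies on the exponent being
    positive.\<close>
  have "continuous_on UNIV (\<lambda>y::real. max y 0 powr (real k / (real k - 1)))"
    by (intro continuous_on_powr' continuous_on_max continuous_on_id continuous_on_const) (use p in auto)
  moreover have "continuous_on UNIV (\<lambda>x::real ^ 'n.
      C - gamma_const CARD('n) k * (norm x / t powr beta_exp CARD('n) k)\<^sup>2)"
    by (intro continuous_intros) (use assms(2) in auto)
  ultimately have "continuous_on UNIV (\<lambda>x::real ^ 'n.
      max (C - gamma_const CARD('n) k * (norm x / t powr beta_exp CARD('n) k)\<^sup>2) 0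
        powr (real k / (real k - 1)))"
    by (rule continuous_on_compose2) simp
  then show ?thesis
    unfolding barenblatt_def by (intro continuous_on_mult continuous_on_const)
qed

theorem mainTheorem4:
  fixes k :: nat and C :: real and U :: "real \<Rightarrow> real ^ 'n \<Rightarrow> real" and R :: "real \<Rightarrow> real"
  assumes "2 \<le> CARD('n)" and "2 \<le> k" and "k \<le> CARD('n)" and "C > 0"
  defines "U \<equiv> barenblatt k C" and "R \<equiv> front_radius CARD('n) k C"
  shows "(\<forall>t>0. \<forall>x. U t x \<ge> 0)
    \<and> self_similar (alpha_exp CARD('n) k) (beta_exp CARD('n) k) U
    \<and> smooth_on {(t, x). t > 0 \<and> norm x \<noteq> R t} (\<lambda>(t, x). U t x)
    \<and> (\<forall>t>0. \<forall>x. norm x \<noteq> R t \<longrightarrow>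
         deriv (\<lambda>s. U s x) t = (-1) ^ (k - 1) * S_k k (hessian (U t) x))
    \<and> (\<forall>t>0. supp (U t) \<subseteq> cball 0 (R t) \<and> compact (supp (U t)))
    \<and> (\<forall>T>0. bounded (\<Union>t\<in>{0<..T}. supp (U t)))
    \<and> (\<exists>M>0. (\<forall>t>0. has_bochner_integral lborel (U t) M)
         \<and> measures_tendsto (\<lambda>t. density lborel (\<lambda>x. ennreal (U t x)))
             (scale_measure (ennreal M) (return borel 0)) (at_right 0))"
proof (intro conjI)
  note nk = assms(1-3) and C = assms(4)
  define b where "b = beta_exp CARD('n) k"
  have b: "b > 0" using beta_exp_pos [OF nk] by (simp add: b_def)
  have vanish: "U t x = 0" if "t > 0" "x \<notin> cball 0 (R t)" for t x
    using barenblatt_eq_0 [OF nk C that(1)] that(2) by (simp add: U_def R_def)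
  have supp: "supp (U t) \<subseteq> cball 0 (R t)" if "t > 0" for t
    unfolding supp_def by (rule closure_minimal) (use vanish [OF that] in blast, simp)
  have U_integrable: "integrable lborel (U t)" if "t > 0" for t
    unfolding U_def using continuous_on_barenblatt [OF nk(2) that] compact_cball [of 0 "R t"]
    by (rule integrable_lborel_compact_support) (use vanish [OF that] in \<open>simp add: U_def\<close>)
  \<comment> \<open>The exponent \<open>\<alpha>\<close> is rewritten as dimension times
    \<open>\<beta>\<close>, the form required by the integral lemmas.\<close>
  have scaling: "U t x = t powr (- (real DIM(real ^ 'n) * b)) * U 1 (x /\<^sub>R t powr b)"
    if "t > 0" for t x
    using barenblatt_self_similar [OF that, of k C x] alpha_exp_eq [OF nk]
    by (simp add: U_def b_def)
  define M where "M = (\<integral>x. U 1 x \<partial>lborel)"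

  show "\<forall>t>0. \<forall>x. U t x \<ge> 0" by (simp add: U_def barenblatt_nonneg)
  show "self_similar (alpha_exp CARD('n) k) (beta_exp CARD('n) k) U"
    unfolding self_similar_def U_def using barenblatt_self_similar by blast
  show "smooth_on {(t, x). t > 0 \<and> norm x \<noteq> R t} (\<lambda>(t, x). U t x)"
    unfolding U_def R_def by (rule smooth_on_barenblatt [OF nk C])
  show "\<forall>t>0. \<forall>x. norm x \<noteq> R t \<longrightarrow>
      deriv (\<lambda>s. U s x) t = (-1) ^ (k - 1) * S_k k (hessian (U t) x)"
    unfolding U_def R_def
    using barenblatt_equation_inside [OF nk C] barenblatt_equation_outside [OF nk C]
    by (metis linorder_neqE_linordered_idom mult_zero_right)
  show "\<forall>t>0. supp (U t) \<subseteq> cball 0 (R t) \<and> compact (supp (U t))"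
  proof (intro allI impI conjI)
    fix t :: real assume "t > 0"
    then show "supp (U t) \<subseteq> cball 0 (R t)" by (rule supp)
    then show "compact (supp (U t))"
      by (metis bounded_cball bounded_subset closed_closure compact_eq_bounded_closed supp_def)
  qed
  show "\<forall>T>0. bounded (\<Union>t\<in>{0<..T}. supp (U t))"
  proof (intro allI impI)
    fix T :: real
    \<comment> \<open>The radius is nondecreasing because \<open>\<beta>\<close> is positive, so the
      ball at time \<open>T\<close> contains all earlier supports.\<close>
    have "R t \<le> R T" if "0 < t" "t \<le> T" for t
      using that b C gamma_const_pos [OF nk] unfolding R_def front_radius_eq [OF nk]
      by (intro mult_right_mono powr_mono2) (auto simp: b_def)
    then have "(\<Union>t\<in>{0<..T}. supp (U t)) \<subseteq> cball 0 (R T)"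
      using supp by fastforce
    then show "bounded (\<Union>t\<in>{0<..T}. supp (U t))"
      using bounded_cball bounded_subset by blast
  qed
  show "\<exists>M>0. (\<forall>t>0. has_bochner_integral lborel (U t) M)
      \<and> measures_tendsto (\<lambda>t. density lborel (\<lambda>x. ennreal (U t x)))
          (scale_measure (ennreal M) (return borel 0)) (at_right 0)"
  proof (intro exI [of _ M] conjI allI impI)
    have R1: "0 < R 1"
      using C gamma_const_pos [OF nk] by (simp add: R_def front_radius_eq [OF nk])
    show "M > 0"
      unfolding M_def
    proof (rule lborel_integral_pos [OF U_integrable, of 1 "ball 0 (R 1)"])
      show "0 < U 1 x" if "x \<in> ball 0 (R 1)" for x
        using barenblatt_eq [OF nk C, of 1 x] that by (simp add: U_def R_def)
    qed (use R1 in \<open>auto simp: U_def barenblatt_nonneg\<close>)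
    show "has_bochner_integral lborel (U t) M" if "t > 0" for t
    proof -
      \<comment> \<open>The factor 1 is the constant test function in the substitution
        lemma.\<close>
      have "(\<integral>x. U t x \<partial>lborel)
          = (\<integral>x. (t powr (- (real DIM(real ^ 'n) * b)) * U 1 (x /\<^sub>R t powr b)) * 1 \<partial>lborel)"
        using scaling [OF that] by simp
      also have "\<dots> = M"
        using that borel_measurable_integrable [OF U_integrable [of 1]]
        by (subst lborel_integral_self_similar) (auto simp: M_def)
      finally show ?thesis
        using U_integrable [OF that] by (simp add: has_bochner_integral_iff)
    qed
    show "measures_tendsto (\<lambda>t. density lborel (\<lambda>x. ennreal (U t x)))
        (scale_measure (ennreal M) (return borel 0)) (at_right 0)"
      unfolding M_def
      by (rule measures_tendsto_self_similar [OF U_integrable _ b scaling])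
         (auto simp: U_def barenblatt_nonneg)
  qed
qed

end
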